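(* There exists a length-preserving bijection $\phi: \mathrm{Av}(312\mid 21) \to \mathrm{Av}(312\mid 12)$.
   Context: Permutations are written in one-line notation. A permutation (or a sequence of distinct integers) contains a permutation $\tau$ of length $k$ as a pattern if it has a (not necessarily contiguous) subsequence of length $k$ whose entries are in the same relative order as those of $\tau$; otherwise it avoids $\tau$. For a permutation $\alpha$ of length three and a permutation $\beta$ of length two, the juxtaposition class $\mathrm{Av}(\alpha\mid\beta)$ is the set of all permutations $\pi$ (of any finite length) whose one-line notation can be written as a concatenation $\pi = AB$ of two (possibly empty) contiguous blocks, such that the prefix $A$ avoids $\alpha$ and the suffix $B$ avoids $\beta$. A map between sets of permutations is length-preserving if it maps each permutation of length $n$ to a permutation of length $n$, for every $n$. *)

theory Defs
  imports "HOL-Combinatorics.Multiset_Permutations" "HOL-Library.Sublist"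
begin

text \<open>A permutation of length \<open>n\<close> is its one-line notation, a list in
  \<open>permutations_of_set {1..n}\<close>; the empty list is the permutation of length 0.\<close>

definition is_permutation :: "nat list \<Rightarrow> bool" where
  "is_permutation p \<longleftrightarrow> p \<in> permutations_of_set {1..length p}"

definition order_isomorphic :: "nat list \<Rightarrow> nat list \<Rightarrow> bool" where
  "order_isomorphic xs ys \<longleftrightarrow> length xs = length ys \<and>
     (\<forall>i < length xs. \<forall>j < length xs. xs ! i < xs ! j \<longleftrightarrow> ys ! i < ys ! j)"

definition contains_pattern :: "nat list \<Rightarrow> nat list \<Rightarrow> bool" where
  "contains_pattern xs t \<longleftrightarrow> (\<exists>ys. subseq ys xs \<and> order_isomorphic ys t)"

abbreviation avoids_pattern :: "nat list \<Rightarrow> nat list \<Rightarrow> bool" where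
  "avoids_pattern xs t \<equiv> \<not> contains_pattern xs t"

definition Av_juxt :: "nat list \<Rightarrow> nat list \<Rightarrow> nat list set" where
  "Av_juxt \<alpha> \<beta> = {p. is_permutation p \<and>
     (\<exists>A B. p = A @ B \<and> avoids_pattern A \<alpha> \<and> avoids_pattern B \<beta>)}"

end

theory Submission
  imports Defs
begin

text \<open>
  It suffices that the two classes have equally many members of each length \<open>n\<close>, and this follows
  by counting cuts instead of permutations. Fix \<open>\<beta>\<close>, which is 21 or 12, and let \<open>X k\<close> be the
  set of permutations of length \<open>n\<close> that may be cut after position \<open>k\<close>: the first \<open>k\<close> entries avoid
  312 and the rest avoids \<open>\<beta>\<close>. Since both conditions pass to shorter blocks, the cuts that work for a
  given permutation are consecutive, so if there are any, there is exactly one more of them than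
  there are adjacent pairs of them. Summing over all permutations (\<open>card_UN_convex\<close>), the size of
  \<open>\<Union>k\<le>n. X k\<close> is the sum of all \<open>card (X k)\<close> minus the sum of all \<open>card (X k \<inter> X (k + 1))\<close>,
  and each of these terms has the same value for both choices of \<open>\<beta>\<close>.

  For a single cut (\<open>card_cut_perms_eq\<close>), reverse the part after it.

  For two adjacent cuts (\<open>card_adjacent_cuts_eq\<close>) let \<open>x\<close> be the entry between them. The entries up
  to and including \<open>x\<close> avoid 312, so those before \<open>x\<close> form two blocks \<open>L U\<close> with \<open>L < x < U\<close>
  entrywise, each avoiding 312. The entries from \<open>x\<close> on avoid \<open>\<beta>\<close>, so for \<open>\<beta> = 21\<close> the part \<open>B\<close>
  after \<open>x\<close> is increasing and lies above \<open>x\<close>; for \<open>\<beta> = 12\<close> it is decreasing and lies below \<open>x\<close>.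
  Hence it is enough to interchange, in position, the blocks \<open>L\<close> and \<open>U\<close>, to interchange, in value,
  the numbers below \<open>x\<close> and those above \<open>x\<close>, and to reverse \<open>B\<close>. Doing this twice restores the permutation. This is the symmetry behind
  the fact that among the 312-avoiders of length \<open>a\<close>, as many end in \<open>j\<close> as in \<open>a + 1 - j\<close>: the
  number is a product of two Catalan numbers, one for each of the lengths \<open>j - 1\<close> and \<open>a - j\<close> of
  \<open>L\<close> and \<open>U\<close>.
\<close>

section \<open>Pattern containment\<close>

lemma contains_pattern_subseq:
  assumes "contains_pattern xs t" "subseq xs ys"
  shows "contains_pattern ys t"
  using assms subseq_order.order_trans unfolding contains_pattern_def by blast

lemma set_subset_if_subseq: "subseq xs ys \<Longrightarrow> set xs \<subseteq> set ys"
  using set_nths_subset by (fastforce simp: subseq_conv_nths)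

lemma order_isomorphic_map:
  assumes "strict_mono_on (set xs) g"
  shows "order_isomorphic (map g xs) t \<longleftrightarrow> order_isomorphic xs t"
  unfolding order_isomorphic_def
  using assms by (auto simp: strict_mono_on_less)

text \<open>Changing the values of a block in an order-preserving way, as the exchange of value ranges
  below does, leaves its patterns alone.\<close>

lemma contains_pattern_map:
  assumes "strict_mono_on (set xs) g"
  shows "contains_pattern (map g xs) t \<longleftrightarrow> contains_pattern xs t"
proof -
  have iso: "order_isomorphic (map g zs) t \<longleftrightarrow> order_isomorphic zs t" if "subseq zs xs" for zs
    by (rule order_isomorphic_map)
      (rule monotone_on_subset[OF assms set_subset_if_subseq[OF that]])
  have "contains_pattern (map g xs) t \<longleftrightarrow> (\<exists>zs. subseq zs xs \<and> order_isomorphic (map g zs) t)"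
  proof
    assume "contains_pattern (map g xs) t"
    then obtain ys where ys: "subseq ys (map g xs)" "order_isomorphic ys t"
      unfolding contains_pattern_def by blast
    from ys(1) obtain N where "ys = nths (map g xs) N"
      by (auto simp: subseq_conv_nths)
    then have "ys = map g (nths xs N)" "subseq (nths xs N) xs"
      by (auto simp: nths_map subseq_conv_nths)
    with ys(2) show "\<exists>zs. subseq zs xs \<and> order_isomorphic (map g zs) t" by blast
  next
    assume "\<exists>zs. subseq zs xs \<and> order_isomorphic (map g zs) t"
    then show "contains_pattern (map g xs) t"
      unfolding contains_pattern_def using subseq_map by blast
  qed
  also have "\<dots> \<longleftrightarrow> contains_pattern xs t"
    unfolding contains_pattern_def using iso by blast
  finally show ?thesis .
qed

lemma sorted_wrt_iff_subseq_pairs: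
  "sorted_wrt P xs \<longleftrightarrow> (\<forall>a b. subseq [a, b] xs \<longrightarrow> P a b)"
proof (induction xs)
  case (Cons x xs)
  have "subseq [a, b] (x # xs) \<longleftrightarrow> (a = x \<and> b \<in> set xs) \<or> subseq [a, b] xs" for a b
    by (auto simp: subseq_singleton_left subseq_Cons' elim: subseq_Cons2_neq split: if_splits
        dest: subseq_Cons')
  then show ?case using Cons by auto
qed simp

lemma order_isomorphic_21: "order_isomorphic ys [2, 1] \<longleftrightarrow> (\<exists>a b. ys = [b, a] \<and> a < b)"
  by (auto simp: order_isomorphic_def length_Suc_conv less_Suc_eq numeral_2_eq_2)

lemma order_isomorphic_12: "order_isomorphic ys [1, 2] \<longleftrightarrow> (\<exists>a b. ys = [a, b] \<and> a < b)"
  by (auto simp: order_isomorphic_def length_Suc_conv less_Suc_eq numeral_2_eq_2)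

lemma order_isomorphic_312:
  "order_isomorphic ys [3, 1, 2] \<longleftrightarrow> (\<exists>a b c. ys = [c, a, b] \<and> a < b \<and> b < c)"
  by (auto simp: order_isomorphic_def length_Suc_conv less_Suc_eq numeral_2_eq_2 numeral_3_eq_3)

lemma avoids_21_iff: "avoids_pattern xs [2, 1] \<longleftrightarrow> sorted_wrt (\<le>) xs"
  unfolding sorted_wrt_iff_subseq_pairs contains_pattern_def order_isomorphic_21
  using linorder_not_less by blast

lemma avoids_12_iff: "avoids_pattern xs [1, 2] \<longleftrightarrow> sorted_wrt (\<ge>) xs"
  unfolding sorted_wrt_iff_subseq_pairs contains_pattern_def order_isomorphic_12
  using linorder_not_less by blast

lemma avoids_12_rev: "avoids_pattern (rev xs) [1, 2] \<longleftrightarrow> avoids_pattern xs [2, 1]"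
  unfolding avoids_21_iff avoids_12_iff by (simp add: sorted_wrt_rev)

lemma contains_312_iff:
  "contains_pattern xs [3, 1, 2] \<longleftrightarrow> (\<exists>a b c. subseq [c, a, b] xs \<and> a < b \<and> b < c)"
  unfolding contains_pattern_def order_isomorphic_312 by blast

section \<open>Permutations that avoid 312 and end in a given value\<close>

text \<open>No occurrence of 312 uses entries of both blocks, because its 3 comes first and is the largest.
  Nor does one use the final \<open>x\<close>: it would play the 2, and the 1 and 3 would lie in different
  blocks.\<close>

lemma contains_312_split:
  assumes "\<And>l. l \<in> set L \<Longrightarrow> l < x" "\<And>u. u \<in> set U \<Longrightarrow> x < u"
  shows "contains_pattern (L @ U @ [x]) [3, 1, 2] \<longleftrightarrow>
    contains_pattern L [3, 1, 2] \<or> contains_pattern U [3, 1, 2]"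
proof
  assume "contains_pattern (L @ U @ [x]) [3, 1, 2]"
  then obtain a b c where s: "subseq [c, a, b] (L @ U @ [x])" and less: "a < b" "b < c"
    unfolding contains_312_iff by blast
  from s obtain s1 s2 s3 where split: "[c, a, b] = s1 @ s2 @ s3"
    and sub: "subseq s1 L" "subseq s2 U" "subseq s3 [x]"
    by (metis subseq_appendE)
  have lt: "\<forall>y \<in> set s1. y < x" "\<forall>y \<in> set s2. x < y"
    using assms set_subset_if_subseq[OF sub(1)] set_subset_if_subseq[OF sub(2)] by blast+
  have s3: "s3 = [] \<or> s3 = [x]"
    using sub(3) by (cases s3) (auto simp: subseq_Cons' split: if_splits)
  have "s1 = [c, a, b] \<or> s2 = [c, a, b]"
    using split lt s3 less by (auto simp: Cons_eq_append_conv)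
  then show "contains_pattern L [3, 1, 2] \<or> contains_pattern U [3, 1, 2]"
    unfolding contains_312_iff using sub less by blast
next
  assume "contains_pattern L [3, 1, 2] \<or> contains_pattern U [3, 1, 2]"
  then show "contains_pattern (L @ U @ [x]) [3, 1, 2]"
    by (meson contains_pattern_subseq list_emb_append2 list_emb_prefix subseq_order.order_refl)
qed

text \<open>A larger entry, a smaller entry and the final \<open>x\<close>, in this order, would form a 312; so all
  smaller entries come first.\<close>

lemma avoids_312_snocE:
  assumes av: "avoids_pattern (A @ [x]) [3, 1, 2]" and "x \<notin> set A"
  obtains L U where "A = L @ U" "\<And>l. l \<in> set L \<Longrightarrow> l < x" "\<And>u. u \<in> set U \<Longrightarrow> x < u"
proof
  let ?L = "takeWhile (\<lambda>v. v < x) A" and ?U = "dropWhile (\<lambda>v. v < x) A"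
  show eq: "A = ?L @ ?U" by simp
  show "l < x" if "l \<in> set ?L" for l using that by (rule set_takeWhileD[THEN conjunct2])
  show "x < u" if u: "u \<in> set ?U" for u
  proof -
    from u obtain c W where W: "?U = c # W" by (cases ?U) auto
    then have "\<not> c < x" by (metis hd_dropWhile list.discI list.sel(1))
    moreover have "c \<noteq> x" using W assms(2) eq by (metis in_set_conv_decomp)
    ultimately have c: "x < c" by simp
    have "\<not> w < x" if "w \<in> set W" for w
    proof
      assume "w < x"
      have "subseq ([] @ [c, w] @ [x]) (?L @ ?U @ [x])"
        using that W by (intro list_emb_append_mono) (auto simp: subseq_singleton_left)
      then have "subseq [c, w, x] (A @ [x])"
        using eq by (simp only: append_assoc[symmetric] append_Nil append_Cons)
      then show False using av c \<open>w < x\<close> unfolding contains_312_iff by blast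
    qed
    moreover have "w \<noteq> x" if "w \<in> set W" for w
      using that W assms(2) eq by (metis list.set_intros(2) set_dropWhileD)
    ultimately show ?thesis using u W c by (metis linorder_neqE_nat set_ConsD)
  qed
qed

section \<open>Cut positions\<close>

definition cut_perms :: "nat list \<Rightarrow> nat \<Rightarrow> nat \<Rightarrow> nat list set" where
  "cut_perms \<beta> n k = {p. is_permutation p \<and> length p = n \<and>
     avoids_pattern (take k p) [3, 1, 2] \<and> avoids_pattern (drop k p) \<beta>}"

lemma is_permutation_iff: "is_permutation p \<longleftrightarrow> set p = {1..length p}"
  unfolding is_permutation_def permutations_of_set_def
  by (auto intro: card_distinct)

lemma finite_cut_perms: "finite (cut_perms \<beta> n k)"
proof (rule finite_subset)
  show "cut_perms \<beta> n k \<subseteq> permutations_of_set {1..n}"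
    unfolding cut_perms_def is_permutation_def by auto
qed simp

lemma Av_juxt_length_eq:
  "{p \<in> Av_juxt [3, 1, 2] \<beta>. length p = n} = (\<Union>k\<le>n. cut_perms \<beta> n k)"
proof (intro equalityI subsetI)
  fix p assume "p \<in> {p \<in> Av_juxt [3, 1, 2] \<beta>. length p = n}"
  then obtain A B where "is_permutation p" "length p = n" "p = A @ B"
    "avoids_pattern A [3, 1, 2]" "avoids_pattern B \<beta>"
    unfolding Av_juxt_def by blast
  then show "p \<in> (\<Union>k\<le>n. cut_perms \<beta> n k)"
    unfolding cut_perms_def by (intro UN_I[of "length A"]) auto
next
  fix p assume "p \<in> (\<Union>k\<le>n. cut_perms \<beta> n k)"
  then show "p \<in> {p \<in> Av_juxt [3, 1, 2] \<beta>. length p = n}"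
    unfolding cut_perms_def Av_juxt_def by (auto intro: append_take_drop_id[symmetric])
qed

text \<open>The cuts that work for a given permutation are consecutive: moving the later one to the left
  shortens the prefix, moving the earlier one to the right shortens the suffix.\<close>

lemma cut_perms_convex:
  assumes "i \<le> j" "j \<le> k"
  shows "cut_perms \<beta> n i \<inter> cut_perms \<beta> n k \<subseteq> cut_perms \<beta> n j"
proof
  fix p assume p: "p \<in> cut_perms \<beta> n i \<inter> cut_perms \<beta> n k"
  have "subseq (take j p) (take k p)"
    using assms(2) by (metis min.absorb1 take_take prefix_imp_subseq take_is_prefix)
  moreover have "subseq (drop j p) (drop i p)"
    using assms(1) by (metis drop_drop le_add_diff_inverse2 suffix_drop suffix_imp_subseq)
  ultimately show "p \<in> cut_perms \<beta> n j"
    using p contains_pattern_subseq unfolding cut_perms_def by blast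
qed

text \<open>The indices \<open>k\<close> with \<open>p \<in> X k\<close> form an interval, so if there are any, there is one more of them
  than there are pairs of neighbours: a path has one vertex more than edges.\<close>

lemma card_UN_convex:
  fixes X :: "nat \<Rightarrow> 'a set"
  assumes fin: "\<And>k. finite (X k)"
    and convex: "\<And>i j k. i \<le> j \<Longrightarrow> j \<le> k \<Longrightarrow> X i \<inter> X k \<subseteq> X j"
  shows "card (\<Union>k\<le>n. X k) + (\<Sum>k<n. card (X k \<inter> X (Suc k))) = (\<Sum>k\<le>n. card (X k))"
proof (induction n)
  case (Suc n)
  have "(\<Union>k\<le>n. X k) \<inter> X (Suc n) = X n \<inter> X (Suc n)"
    using convex[of _ n "Suc n"] by fastforce
  moreover have "card (\<Union>k\<le>n. X k) + card (X (Suc n)) =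
      card (\<Union>k\<le>Suc n. X k) + card ((\<Union>k\<le>n. X k) \<inter> X (Suc n))"
    using card_Un_Int[of "\<Union>k\<le>n. X k" "X (Suc n)"] fin by (simp add: atMost_Suc Un_commute)
  ultimately show ?case using Suc.IH by simp
qed simp

lemma card_cut_perms_eq: "card (cut_perms [2, 1] n k) = card (cut_perms [1, 2] n k)"
proof -
  let ?r = "\<lambda>p :: nat list. take k p @ rev (drop k p)"
  have inv: "?r (?r p) = p" for p
    by (cases "k \<le> length p") auto
  have perm: "is_permutation (?r p) \<longleftrightarrow> is_permutation p" for p
  proof -
    have "set (?r p) = set p" by (metis append_take_drop_id set_append set_rev)
    moreover have "length (?r p) = length p" by simp
    ultimately show ?thesis unfolding is_permutation_iff by simp
  qed
  have len: "length (?r p) = length p" for p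
    by simp
  have cut: "take k (?r p) = take k p" "drop k (?r p) = rev (drop k p)" for p
    by (cases "k \<le> length p"; simp)+
  have "bij_betw ?r (cut_perms [2, 1] n k) (cut_perms [1, 2] n k)"
  proof (rule bij_betw_byWitness[where f' = ?r])
    show "?r ` cut_perms [2, 1] n k \<subseteq> cut_perms [1, 2] n k"
      unfolding cut_perms_def image_subset_iff mem_Collect_eq cut perm len avoids_12_rev by simp
    show "?r ` cut_perms [1, 2] n k \<subseteq> cut_perms [2, 1] n k"
      unfolding cut_perms_def image_subset_iff mem_Collect_eq cut perm len
        avoids_12_rev[symmetric] rev_rev_ident by simp
  qed (use inv in auto)
  then show ?thesis by (rule bij_betw_same_card)
qed

section \<open>Two adjacent cut positions\<close>

text \<open>This carries \<open>{1..<x}\<close> to the top and \<open>{x<..n}\<close> to the bottom of \<open>{1..n}\<close>, each by a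
  translation. The value \<open>x\<close> separating the two ranges goes to \<open>n + 1 - x\<close>, which separates their
  images.\<close>

definition swap_values :: "nat \<Rightarrow> nat \<Rightarrow> nat \<Rightarrow> nat" where
  "swap_values n x v = (if v = x then n + 1 - x else if x < v then v - x else v + (n + 1 - x))"

lemma swap_values_inverse:
  "x \<in> {1..n} \<Longrightarrow> v \<in> {1..n} \<Longrightarrow> swap_values n (n + 1 - x) (swap_values n x v) = v"
  unfolding swap_values_def by auto

lemma swap_values_image:
  assumes "x \<in> {1..n}" shows "swap_values n x ` {1..n} = {1..n}"
proof -
  have sub: "swap_values n y ` {1..n} \<subseteq> {1..n}" if "y \<in> {1..n}" for y
    using that unfolding swap_values_def by auto
  have "inj_on (swap_values n x) {1..n}"
    using swap_values_inverse[OF assms] by (metis inj_onI)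
  with sub[OF assms] show ?thesis by (simp add: endo_inj_surj)
qed

text \<open>The blocks \<open>L\<close> and \<open>U\<close> are recovered from the first \<open>k\<close> entries by comparison with entry \<open>k\<close>
  (counting from 0), so that one map serves both \<open>\<beta>\<close> and is its own inverse.\<close>

definition swap_blocks :: "nat \<Rightarrow> nat list \<Rightarrow> nat list" where
  "swap_blocks k p = map (swap_values (length p) (p ! k))
     (filter (\<lambda>v. p ! k < v) (take k p) @ filter (\<lambda>v. v < p ! k) (take k p) @
      p ! k # rev (drop (Suc k) p))"

lemma swap_blocks_append:
  assumes "\<And>l. l \<in> set L \<Longrightarrow> l < x" "\<And>u. u \<in> set U \<Longrightarrow> x < u"
    and "length L + length U = k"
  shows "swap_blocks k (L @ U @ x # B) =
    map (swap_values (length (L @ U @ x # B)) x) (U @ L @ x # rev B)"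
proof -
  have eq: "L @ U @ x # B = (L @ U) @ x # B" by simp
  have k: "k = length (L @ U)" using assms by simp
  have "(L @ U @ x # B) ! k = x" "take k (L @ U @ x # B) = L @ U" "drop (Suc k) (L @ U @ x # B) = B"
    unfolding eq k by (simp_all only: nth_append_length append_eq_conv_conj) simp_all
  moreover have "filter (\<lambda>v. x < v) (L @ U) = U" "filter (\<lambda>v. v < x) (L @ U) = L"
    using assms(1,2) by (auto simp: filter_id_conv filter_empty_conv dest: less_asym)
  ultimately show ?thesis unfolding swap_blocks_def by simp
qed

text \<open>The shape of a permutation with two adjacent cuts, whose common entry is \<open>x\<close>. That \<open>B\<close> lies on
  one side of \<open>x\<close> is not listed separately: it follows from \<open>x # B\<close> being monotone with distinct
  entries.\<close>

definition block_form :: "nat list \<Rightarrow> nat \<Rightarrow> nat \<Rightarrow> nat list \<Rightarrow> nat list \<Rightarrow> nat \<Rightarrow> nat list \<Rightarrow> bool" where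
  "block_form \<beta> n k L U x B \<longleftrightarrow>
     set (L @ U @ x # B) = {1..n} \<and> length (L @ U @ x # B) = n \<and> length L + length U = k \<and>
     (\<forall>l \<in> set L. l < x) \<and> (\<forall>u \<in> set U. x < u) \<and>
     avoids_pattern L [3, 1, 2] \<and> avoids_pattern U [3, 1, 2] \<and> avoids_pattern (x # B) \<beta>"

lemma mem_adjacent_cuts_iff:
  assumes "k < n"
  shows "p \<in> cut_perms \<beta> n k \<inter> cut_perms \<beta> n (Suc k) \<longleftrightarrow>
    (\<exists>L U x B. p = L @ U @ x # B \<and> block_form \<beta> n k L U x B)"
proof
  assume p: "p \<in> cut_perms \<beta> n k \<inter> cut_perms \<beta> n (Suc k)"
  then have len: "length p = n" and set: "set p = {1..n}"
    and av: "avoids_pattern (take (Suc k) p) [3, 1, 2]" "avoids_pattern (drop k p) \<beta>"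
    unfolding cut_perms_def is_permutation_iff by auto
  let ?A = "take k p" and ?x = "p ! k" and ?B = "drop (Suc k) p"
  have dist: "distinct p" using len set by (simp add: card_distinct)
  have p_eq: "p = ?A @ ?x # ?B" using assms len by (simp add: id_take_nth_drop)
  have "?x \<notin> set ?A" using dist p_eq by (metis distinct_append disjoint_iff list.set_intros(1))
  moreover have snoc: "avoids_pattern (?A @ [?x]) [3, 1, 2]"
    using av(1) assms len by (simp add: take_Suc_conv_app_nth)
  ultimately obtain L U where LU: "?A = L @ U"
    "\<And>l. l \<in> set L \<Longrightarrow> l < ?x" "\<And>u. u \<in> set U \<Longrightarrow> ?x < u"
    using avoids_312_snocE by metis
  have "avoids_pattern L [3, 1, 2]" "avoids_pattern U [3, 1, 2]"
    using snoc LU contains_312_split[OF LU(2,3)] by auto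
  moreover have "avoids_pattern (?x # ?B) \<beta>"
    using av(2) assms len by (simp add: Cons_nth_drop_Suc)
  moreover have "length L + length U = k"
    using LU(1) assms len by (metis length_append length_take min.absorb4)
  moreover have eq: "p = L @ U @ ?x # ?B" using p_eq LU(1) by simp
  ultimately have "block_form \<beta> n k L U ?x ?B"
    unfolding block_form_def using LU len set by (metis (no_types))
  then show "\<exists>L U x B. p = L @ U @ x # B \<and> block_form \<beta> n k L U x B" using eq by blast
next
  assume "\<exists>L U x B. p = L @ U @ x # B \<and> block_form \<beta> n k L U x B"
  then obtain L U x B where p: "p = L @ U @ x # B" and bf: "block_form \<beta> n k L U x B" by blast
  have k: "k = length (L @ U)" using bf unfolding block_form_def by simp
  have cuts: "take k p = L @ U" "take (Suc k) p = L @ U @ [x]" "drop k p = x # B" "drop (Suc k) p = B"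
    unfolding p k by simp_all
  have "avoids_pattern (L @ U @ [x]) [3, 1, 2]"
    using bf contains_312_split[of L x U] unfolding block_form_def by blast
  moreover from this have "avoids_pattern (L @ U) [3, 1, 2]"
    using contains_pattern_subseq[of "L @ U" _ "(L @ U) @ [x]"] by fastforce
  moreover have "avoids_pattern (x # B) \<beta>" using bf unfolding block_form_def by blast
  moreover from this have "avoids_pattern B \<beta>"
    by (meson contains_pattern_subseq list_emb_Cons subseq_order.order_refl)
  ultimately show "p \<in> cut_perms \<beta> n k \<inter> cut_perms \<beta> n (Suc k)"
    using bf p unfolding cut_perms_def cuts is_permutation_iff block_form_def Int_iff mem_Collect_eq
    by (metis cuts(2))
qed

text \<open>The entries of \<open>B\<close> all lie on one side of \<open>x\<close>, where \<open>swap_values\<close> is a translation that carries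
  them to the other side of the image of \<open>x\<close>. Reversing \<open>B\<close> as well changes an increasing
  \<open>x # B\<close> into a decreasing list, and vice versa.\<close>

lemma block_form_swap:
  assumes bf: "block_form \<beta> n k L U x B" and rev: "{\<beta>, \<beta>'} = {[2, 1], [1, 2]}"
  defines "g \<equiv> swap_values n x"
  shows "block_form \<beta>' n k (map g U) (map g L) (g x) (map g (rev B))"
proof -
  have set: "set (L @ U @ x # B) = {1..n}" and len: "length (L @ U @ x # B) = n"
    "length L + length U = k"
    and lu: "\<And>l. l \<in> set L \<Longrightarrow> l < x" "\<And>u. u \<in> set U \<Longrightarrow> x < u"
    and av: "avoids_pattern L [3, 1, 2]" "avoids_pattern U [3, 1, 2]" "avoids_pattern (x # B) \<beta>"
    using bf unfolding block_form_def by auto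
  have x: "x \<in> {1..n}" using set by auto
  have range: "v \<in> {1..n}" if "v \<in> set L \<union> set U \<union> set B" for v
    using that unfolding set[symmetric] by auto
  have gx: "g x = n + 1 - x" unfolding g_def swap_values_def by simp
  have g_less: "g v = v + (n + 1 - x)" if "v < x" for v
    using that unfolding g_def swap_values_def by simp
  have g_greater: "g v = v - x" if "x < v" for v
    using that unfolding g_def swap_values_def by simp
  have "set (map g U @ map g L @ g x # map g (rev B)) = g ` set (L @ U @ x # B)" by auto
  then have set': "set (map g U @ map g L @ g x # map g (rev B)) = {1..n}"
    unfolding set g_def swap_values_image[OF x] .
  have "strict_mono_on (set L) g" "strict_mono_on (set U) g"
    using lu g_less g_greater by (auto intro!: strict_mono_onI diff_less_mono less_imp_le)
  then have av': "avoids_pattern (map g L) [3, 1, 2]" "avoids_pattern (map g U) [3, 1, 2]"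
    using av contains_pattern_map by blast+
  have "v - x < n + 1 - x" if "v \<in> set U" for v
    using lu(2)[OF that] range[of v] that by auto
  then have U': "\<And>u. u \<in> set (map g U) \<Longrightarrow> u < g x"
    using lu(2) g_greater gx by auto
  have "n + 1 - x < v + (n + 1 - x)" if "v \<in> set L" for v
    using range[of v] that by auto
  then have L': "\<And>l. l \<in> set (map g L) \<Longrightarrow> g x < l"
    using lu(1) g_less gx by auto
  have "card (set (L @ U @ x # B)) = length (L @ U @ x # B)"
    using set len by simp
  then have "distinct (x # B)"
    by (metis card_distinct distinct_append)
  then have x_B: "b \<noteq> x" if "b \<in> set B" for b
    using that by auto
  from rev consider "\<beta> = [2, 1]" "\<beta>' = [1, 2]" | "\<beta> = [1, 2]" "\<beta>' = [2, 1]"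
    by (auto simp: doubleton_eq_iff)
  then have "avoids_pattern (g x # map g (rev B)) \<beta>'"
  proof cases
    case 1
    then have sorted: "sorted_wrt (\<le>) B" and less: "\<And>b. b \<in> set B \<Longrightarrow> x < b"
      using av(3) x_B unfolding 1 avoids_21_iff by (auto simp: le_less)
    have "sorted_wrt (\<lambda>a b. g a \<le> g b) B"
      using sorted by (rule sorted_wrt_mono_rel[rotated]) (use less g_greater in auto)
    moreover have "g b \<le> g x" if "b \<in> set B" for b
      using that less[OF that] range[of b] that g_greater gx by simp
    ultimately show ?thesis
      unfolding 1 avoids_12_iff by (simp add: sorted_wrt_map sorted_wrt_rev)
  next
    case 2
    then have sorted: "sorted_wrt (\<ge>) B" and less: "\<And>b. b \<in> set B \<Longrightarrow> b < x"
      using av(3) x_B unfolding 2 avoids_12_iff by (auto simp: le_less)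
    have "sorted_wrt (\<lambda>a b. g a \<ge> g b) B"
      using sorted by (rule sorted_wrt_mono_rel[rotated]) (use less g_less in auto)
    moreover have "g b \<ge> g x" if "b \<in> set B" for b
      using that less[OF that] g_less gx by simp
    ultimately show ?thesis
      unfolding 2 avoids_21_iff by (simp add: sorted_wrt_map sorted_wrt_rev)
  qed
  then show ?thesis
    unfolding block_form_def using set' len U' L' av' by auto
qed

lemma card_adjacent_cuts_eq:
  assumes "k < n"
  shows "card (cut_perms [2, 1] n k \<inter> cut_perms [2, 1] n (Suc k)) =
    card (cut_perms [1, 2] n k \<inter> cut_perms [1, 2] n (Suc k))"
    (is "card (?Y [2, 1]) = card (?Y [1, 2])")
proof -
  have swap: "swap_blocks k p \<in> ?Y \<beta>' \<and> swap_blocks k (swap_blocks k p) = p"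
    if p: "p \<in> ?Y \<beta>" and rev: "{\<beta>, \<beta>'} = {[2, 1], [1, 2]}" for p \<beta> \<beta>'
  proof -
    obtain L U x B where p_eq: "p = L @ U @ x # B" and bf: "block_form \<beta> n k L U x B"
      using p mem_adjacent_cuts_iff[OF assms] by blast
    let ?g = "swap_values n x"
    let ?h = "swap_values n (n + 1 - x)"
    have set: "set p = {1..n}" and len: "length p = n"
      using bf unfolding block_form_def p_eq by auto
    have x: "x \<in> {1..n}" using set p_eq by auto
    have bf': "block_form \<beta>' n k (map ?g U) (map ?g L) (?g x) (map ?g (rev B))"
      using block_form_swap[OF bf rev] .
    have q_eq: "swap_blocks k p = map ?g U @ map ?g L @ ?g x # map ?g (rev B)"
      using swap_blocks_append[of L x U k B] bf len unfolding block_form_def p_eq by simp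
    have "swap_blocks k (swap_blocks k p) =
        map (swap_values n (?g x)) (map ?g L @ map ?g U @ ?g x # rev (map ?g (rev B)))"
      using swap_blocks_append[of "map ?g U" "?g x" "map ?g L" k "map ?g (rev B)"] bf'
      unfolding block_form_def q_eq by metis
    also have "\<dots> = map (\<lambda>v. ?h (?g v)) p"
      unfolding p_eq by (simp add: rev_map swap_values_def)
    also have "\<dots> = p"
      using swap_values_inverse[OF x] set by (intro map_idI) blast
    finally show ?thesis
      using bf' q_eq mem_adjacent_cuts_iff[OF assms] by blast
  qed
  have "bij_betw (swap_blocks k) (?Y [2, 1]) (?Y [1, 2])"
  proof (rule bij_betw_byWitness[where f' = "swap_blocks k"])
    show "\<forall>p \<in> ?Y [2, 1]. swap_blocks k (swap_blocks k p) = p"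
      "swap_blocks k ` ?Y [2, 1] \<subseteq> ?Y [1, 2]"
      using swap[of _ "[2, 1]" "[1, 2]"] by auto
    show "\<forall>p \<in> ?Y [1, 2]. swap_blocks k (swap_blocks k p) = p"
      "swap_blocks k ` ?Y [1, 2] \<subseteq> ?Y [2, 1]"
      using swap[of _ "[1, 2]" "[2, 1]"] by auto
  qed
  then show ?thesis by (rule bij_betw_same_card)
qed

section \<open>The length-preserving bijection\<close>

text \<open>Bijections between corresponding fibres are chosen independently and glued.\<close>

lemma bij_betw_preserving_if_card_fibres_eq:
  assumes fin: "\<And>n. finite {p \<in> S. f p = n}" "\<And>n. finite {p \<in> T. f p = n}"
    and card: "\<And>n. card {p \<in> S. f p = n} = card {p \<in> T. f p = n}"
  shows "\<exists>\<phi>. bij_betw \<phi> S T \<and> (\<forall>p \<in> S. f (\<phi> p) = f p)"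
proof -
  have "\<forall>n. \<exists>h. bij_betw h {p \<in> S. f p = n} {p \<in> T. f p = n}"
    using finite_same_card_bij[OF fin card] by (rule allI)
  from choice[OF this] obtain h
    where "\<forall>n. bij_betw (h n) {p \<in> S. f p = n} {p \<in> T. f p = n}" ..
  then have h: "bij_betw (h n) {p \<in> S. f p = n} {p \<in> T. f p = n}" for n
    by (rule spec)
  define \<phi> where "\<phi> p = h (f p) p" for p
  have img: "\<phi> p \<in> T \<and> f (\<phi> p) = f p" if "p \<in> S" for p
    using bij_betw_apply[OF h[of "f p"], of p] that unfolding \<phi>_def by auto
  have "inj_on \<phi> S"
  proof (rule inj_onI)
    fix p q assume pq: "p \<in> S" "q \<in> S" "\<phi> p = \<phi> q"
    then have f_eq: "f p = f q" using img by metis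
    then have "h (f p) p = h (f p) q" using pq(3) unfolding \<phi>_def by simp
    then show "p = q"
      using inj_onD[OF bij_betw_imp_inj_on[OF h[of "f p"]]] pq(1,2) f_eq by simp
  qed
  moreover have "\<phi> ` S = T"
  proof
    show "\<phi> ` S \<subseteq> T" using img by blast
    show "T \<subseteq> \<phi> ` S"
    proof
      fix t assume "t \<in> T"
      then obtain p where "p \<in> S" "f p = f t" "t = h (f t) p"
        using bij_betw_imp_surj_on[OF h[of "f t"]] by blast
      then have "t = \<phi> p" unfolding \<phi>_def by simp
      with \<open>p \<in> S\<close> show "t \<in> \<phi> ` S" by blast
    qed
  qed
  ultimately show ?thesis using img unfolding bij_betw_def by blast
qed

theorem theorem6:
  "\<exists>\<phi> :: nat list \<Rightarrow> nat list.
     bij_betw \<phi> (Av_juxt [3, 1, 2] [2, 1]) (Av_juxt [3, 1, 2] [1, 2]) \<and>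
     (\<forall>p \<in> Av_juxt [3, 1, 2] [2, 1]. length (\<phi> p) = length p)"
proof (rule bij_betw_preserving_if_card_fibres_eq)
  fix n
  show "finite {p \<in> Av_juxt [3, 1, 2] [2, 1]. length p = n}"
    "finite {p \<in> Av_juxt [3, 1, 2] [1, 2]. length p = n}"
    unfolding Av_juxt_length_eq using finite_cut_perms by auto
  have count: "card (\<Union>k\<le>n. cut_perms \<beta> n k) +
      (\<Sum>k<n. card (cut_perms \<beta> n k \<inter> cut_perms \<beta> n (Suc k))) =
      (\<Sum>k\<le>n. card (cut_perms \<beta> n k))" for \<beta>
    using finite_cut_perms cut_perms_convex by (rule card_UN_convex)
  show "card {p \<in> Av_juxt [3, 1, 2] [2, 1]. length p = n} =
      card {p \<in> Av_juxt [3, 1, 2] [1, 2]. length p = n}"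
    unfolding Av_juxt_length_eq
    using count[of "[2, 1]"] count[of "[1, 2]"] card_cut_perms_eq[of n] card_adjacent_cuts_eq[of _ n]
    by simp
qed

end
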